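(* Let $M$ be a non-commutative monoid. Then the restricted direct power $M^{(\infty)}$ is not $\mathbf{q}_\omega$-compact (in the language $\mathcal{L}_m(M^{(\infty)})$).
   Context: $M^\infty=\prod_{i=1}^\infty M$ is the monoid of all sequences $(m_1,m_2,\dots)$ with $m_i\in M$ and componentwise operations; $M^{(\infty)}$ is its submonoid of all sequences with only finitely many indices $i$ such that $m_i\neq 1$. $\mathcal{L}_m=\{\cdot,1\}$ is the language of monoids, and for a monoid $H$, $\mathcal{L}_m(H)$ is $\mathcal{L}_m$ extended by a constant symbol for every element of $H$ (interpreted as that element). An $\mathcal{L}_m(H)$-equation is an equality $p(X)=q(X)$ of two terms of $\mathcal{L}_m(H)$. A system is an arbitrary set of equations in a finite set of variables $X=\{x_1,\dots,x_n\}$; $\mathrm{V}_H(\mathbf{S})\subseteq H^n$ denotes its set of solutions in $H$. A monoid $H$ is $\mathbf{q}_\omega$-compact if for every infinite system $\mathbf{S}$ of $\mathcal{L}_m(H)$-equations (in finitely many variables $X$) and every $\mathcal{L}_m(H)$-equation $p(X)=q(X)$ with $\mathrm{V}_H(\mathbf{S})\subseteq \mathrm{V}_H(p(X)=q(X))$ there is a finite subsystem $\mathbf{S}'\subseteq\mathbf{S}$ with $\mathrm{V}_H(\mathbf{S}')\subseteq \mathrm{V}_H(p(X)=q(X))$. *)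

theory Defs
  imports "HOL-Algebra.Product_Groups"
begin

section \<open>Direct powers\<close>

text \<open>
  Despite its name, the library's \<open>product_group\<close> is the plain componentwise product and makes
  sense for arbitrary monoids.  Its \<open>sum_group\<close> does not: it is generated as a subgroup, hence uses
  inverses.  The restricted power is therefore defined directly on its carrier.
\<close>

definition direct_power :: "('a, 'b) monoid_scheme \<Rightarrow> (nat \<Rightarrow> 'a) monoid" where
  "direct_power M = product_group UNIV (\<lambda>_. M)"

definition finite_support :: "('a, 'b) monoid_scheme \<Rightarrow> (nat \<Rightarrow> 'a) set" where
  "finite_support M = {m \<in> carrier (direct_power M). finite {i. m i \<noteq> \<one>\<^bsub>M\<^esub>}}"

definition restricted_power :: "('a, 'b) monoid_scheme \<Rightarrow> (nat \<Rightarrow> 'a) monoid" where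
  "restricted_power M = (direct_power M)\<lparr>carrier := finite_support M\<rparr>"

lemma monoid_direct_power:
  assumes "monoid M"
  shows "monoid (direct_power M)"
proof -
  interpret monoid M by fact
  show ?thesis
    by unfold_locales (auto simp: direct_power_def m_assoc PiE_UNIV_domain Pi_iff fun_eq_iff)
qed

lemma submonoid_finite_support:
  assumes "monoid M"
  shows "submonoid (finite_support M) (direct_power M)"
proof -
  interpret monoid M by fact
  show ?thesis
  proof
    fix x y assume x: "x \<in> finite_support M" and y: "y \<in> finite_support M"
    have "{i. x i \<otimes>\<^bsub>M\<^esub> y i \<noteq> \<one>\<^bsub>M\<^esub>} \<subseteq> {i. x i \<noteq> \<one>\<^bsub>M\<^esub>} \<union> {i. y i \<noteq> \<one>\<^bsub>M\<^esub>}"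
      by auto
    moreover have "finite ({i. x i \<noteq> \<one>\<^bsub>M\<^esub>} \<union> {i. y i \<noteq> \<one>\<^bsub>M\<^esub>})"
      using x y by (simp add: finite_support_def)
    ultimately have "finite {i. x i \<otimes>\<^bsub>M\<^esub> y i \<noteq> \<one>\<^bsub>M\<^esub>}"
      by (rule finite_subset)
    with x y show "x \<otimes>\<^bsub>direct_power M\<^esub> y \<in> finite_support M"
      by (auto simp: finite_support_def direct_power_def PiE_UNIV_domain)
  qed (auto simp: finite_support_def direct_power_def PiE_UNIV_domain)
qed

lemma monoid_restricted_power:
  assumes "monoid M"
  shows "monoid (restricted_power M)"
  unfolding restricted_power_def
  by (rule submonoid.submonoid_is_monoid[OF submonoid_finite_support monoid_direct_power])
    (fact assms)+

section \<open>Equations over a monoid\<close>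

text \<open>
  The symbol \<open>One_tm\<close> of the language of monoids and the constant symbol \<open>Const_tm\<close> for the
  identity element of the coefficient monoid are distinct symbols with the same interpretation.
\<close>

datatype 'h mterm =
    Var_tm nat
  | Const_tm 'h
  | One_tm
  | Mult_tm "'h mterm" "'h mterm"

text \<open>
  The terms of the language \<open>L\<^sub>m(H)\<close> in the variables \<open>x\<^sub>1, \<dots>, x\<^sub>n\<close>, which are encoded
  as \<open>Var_tm 0, \<dots>, Var_tm (n - 1)\<close>.
\<close>

inductive_set Lm_terms :: "('h, 'b) monoid_scheme \<Rightarrow> nat \<Rightarrow> 'h mterm set"
  for H :: "('h, 'b) monoid_scheme" and n :: nat
  where
    Var: "i < n \<Longrightarrow> Var_tm i \<in> Lm_terms H n"
  | Const: "h \<in> carrier H \<Longrightarrow> Const_tm h \<in> Lm_terms H n"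
  | One: "One_tm \<in> Lm_terms H n"
  | Mult: "s \<in> Lm_terms H n \<Longrightarrow> t \<in> Lm_terms H n \<Longrightarrow> Mult_tm s t \<in> Lm_terms H n"

primrec tm_eval :: "('h, 'b) monoid_scheme \<Rightarrow> (nat \<Rightarrow> 'h) \<Rightarrow> 'h mterm \<Rightarrow> 'h" where
  "tm_eval H x (Var_tm i) = x i"
| "tm_eval H x (Const_tm h) = h"
| "tm_eval H x One_tm = \<one>\<^bsub>H\<^esub>"
| "tm_eval H x (Mult_tm s t) = tm_eval H x s \<otimes>\<^bsub>H\<^esub> tm_eval H x t"

text \<open>An equation \<open>p = q\<close> is the pair \<open>(p, q)\<close>.\<close>

definition Lm_equations :: "('h, 'b) monoid_scheme \<Rightarrow> nat \<Rightarrow> ('h mterm \<times> 'h mterm) set" where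
  "Lm_equations H n = Lm_terms H n \<times> Lm_terms H n"

text \<open>Points of \<open>H\<^sup>n\<close> are extensional functions on \<open>{..<n}\<close>.\<close>

definition solutions ::
  "('h, 'b) monoid_scheme \<Rightarrow> nat \<Rightarrow> ('h mterm \<times> 'h mterm) set \<Rightarrow> (nat \<Rightarrow> 'h) set" where
  "solutions H n S =
     {x \<in> {..<n} \<rightarrow>\<^sub>E carrier H. \<forall>(p, q) \<in> S. tm_eval H x p = tm_eval H x q}"

definition q_omega_compact :: "('h, 'b) monoid_scheme \<Rightarrow> bool" where
  "q_omega_compact H \<longleftrightarrow>
     (\<forall>n S p q.
        S \<subseteq> Lm_equations H n \<and> infinite S \<and> (p, q) \<in> Lm_equations H n \<and>
        solutions H n S \<subseteq> solutions H n {(p, q)} \<longrightarrow>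
        (\<exists>S' \<subseteq> S. finite S' \<and> solutions H n S' \<subseteq> solutions H n {(p, q)}))"

end

theory Submission
  imports Defs
begin

text \<open>
  The solutions of the system \<open>x c = c x\<close>, one equation for each element \<open>c\<close> of a monoid \<open>H\<close>, are
  the central elements, so the system implies \<open>x y = y x\<close>.  A finite subsystem only says that \<open>x\<close>
  commutes with the elements of a finite set \<open>T\<close>.  Hence \<open>H\<close> is not \<open>q\<^sub>\<omega>\<close>-compact as soon as no
  finite \<open>T\<close> has a central centralizer (\<open>not_q_omega_compact_if_noncentral_centralizers\<close>).

  In a restricted power of \<open>M\<close>, the supports of the elements of a finite \<open>T\<close> miss a common index
  \<open>k\<close>.  If \<open>a b \<noteq> b a\<close> in \<open>M\<close>, then the sequence with \<open>a\<close> at \<open>k\<close> and \<open>\<one>\<close> elsewhere commutes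
  with all of \<open>T\<close>, but not with the corresponding sequence for \<open>b\<close>
  (\<open>restricted_power_noncentral_centralizer\<close>).
\<close>

definition commuting_equation :: "'h mterm \<Rightarrow> 'h mterm \<Rightarrow> 'h mterm \<times> 'h mterm" where
  "commuting_equation s t = (Mult_tm s t, Mult_tm t s)"

definition centrality_system :: "'h set \<Rightarrow> ('h mterm \<times> 'h mterm) set" where
  "centrality_system T = (\<lambda>c. commuting_equation (Var_tm 0) (Const_tm c)) ` T"

lemma commuting_equation_in_Lm_equations:
  assumes "s \<in> Lm_terms H n" and "t \<in> Lm_terms H n"
  shows "commuting_equation s t \<in> Lm_equations H n"
  using assms by (simp add: commuting_equation_def Lm_equations_def Lm_terms.Mult)

lemma solutions_commuting_variables:
  "solutions H n {commuting_equation (Var_tm i) (Var_tm j)} =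
     {z \<in> {..<n} \<rightarrow>\<^sub>E carrier H. z i \<otimes>\<^bsub>H\<^esub> z j = z j \<otimes>\<^bsub>H\<^esub> z i}"
  by (simp add: solutions_def commuting_equation_def)

lemma solutions_centrality_system:
  "solutions H n (centrality_system T) =
     {z \<in> {..<n} \<rightarrow>\<^sub>E carrier H. \<forall>c\<in>T. z 0 \<otimes>\<^bsub>H\<^esub> c = c \<otimes>\<^bsub>H\<^esub> z 0}"
  by (auto simp: solutions_def centrality_system_def commuting_equation_def)

text \<open>
  The second variable is unconstrained by the system and only serves to express that \<open>x\<close> is
  central.  That the system is infinite comes for free: if it were finite, it would be one of its
  own finite subsystems, and these do not imply \<open>x y = y x\<close>.
\<close>

lemma not_q_omega_compact_if_noncentral_centralizers:
  fixes H :: "('h, 'b) monoid_scheme"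
  assumes noncentral: "\<And>T. T \<subseteq> carrier H \<Longrightarrow> finite T \<Longrightarrow>
    \<exists>x\<in>carrier H. \<exists>y\<in>carrier H.
      (\<forall>c\<in>T. x \<otimes>\<^bsub>H\<^esub> c = c \<otimes>\<^bsub>H\<^esub> x) \<and> x \<otimes>\<^bsub>H\<^esub> y \<noteq> y \<otimes>\<^bsub>H\<^esub> x"
  shows "\<not> q_omega_compact H"
proof
  assume compact: "q_omega_compact H"
  let ?S = "centrality_system (carrier H)"
  let ?e = "commuting_equation (Var_tm 0) (Var_tm 1) :: 'h mterm \<times> 'h mterm"
  have not_implied: "\<not> solutions H 2 S' \<subseteq> solutions H 2 {?e}"
    if S': "S' \<subseteq> ?S" "finite S'" for S'
  proof -
    obtain T where T: "T \<subseteq> carrier H" "finite T" "S' = centrality_system T"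
      using finite_subset_image[OF S'(2)] S'(1) unfolding centrality_system_def by metis
    obtain x y where xy: "x \<in> carrier H" "y \<in> carrier H"
        "\<forall>c\<in>T. x \<otimes>\<^bsub>H\<^esub> c = c \<otimes>\<^bsub>H\<^esub> x" "x \<otimes>\<^bsub>H\<^esub> y \<noteq> y \<otimes>\<^bsub>H\<^esub> x"
      using noncentral[OF T(1,2)] by blast
    define z where "z = (\<lambda>i\<in>{..<2::nat}. if i = 0 then x else y)"
    have "z \<in> solutions H 2 S'" and "z \<notin> solutions H 2 {?e}"
      using xy by (auto simp: z_def T(3) solutions_centrality_system solutions_commuting_variables)
    then show ?thesis by blast
  qed
  have implied: "solutions H 2 ?S \<subseteq> solutions H 2 {?e}"
    by (auto simp: solutions_centrality_system solutions_commuting_variables)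
  have "?S \<subseteq> Lm_equations H 2" and "?e \<in> Lm_equations H 2"
    by (auto simp: centrality_system_def
        intro!: commuting_equation_in_Lm_equations Lm_terms.Var Lm_terms.Const)
  moreover have "infinite ?S"
    using not_implied[OF subset_refl] implied by blast
  ultimately have "\<exists>S'\<subseteq>?S. finite S' \<and> solutions H 2 S' \<subseteq> solutions H 2 {?e}"
    using compact implied unfolding q_omega_compact_def commuting_equation_def by blast
  then show False using not_implied by blast
qed

lemma carrier_restricted_power:
  "carrier (restricted_power M) =
     {m. (\<forall>i. m i \<in> carrier M) \<and> finite {i. m i \<noteq> \<one>\<^bsub>M\<^esub>}}"
  by (auto simp: restricted_power_def finite_support_def direct_power_def PiE_UNIV_domain)

lemma mult_restricted_power:
  "x \<otimes>\<^bsub>restricted_power M\<^esub> y = (\<lambda>i. x i \<otimes>\<^bsub>M\<^esub> y i)"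
  by (simp add: restricted_power_def direct_power_def fun_eq_iff)

lemma restricted_power_noncentral_centralizer:
  fixes M :: "('a, 'b) monoid_scheme"
  assumes "monoid M" and a: "a \<in> carrier M" and b: "b \<in> carrier M"
    and ab: "a \<otimes>\<^bsub>M\<^esub> b \<noteq> b \<otimes>\<^bsub>M\<^esub> a"
    and T: "T \<subseteq> carrier (restricted_power M)" "finite T"
  shows "\<exists>x\<in>carrier (restricted_power M). \<exists>y\<in>carrier (restricted_power M).
      (\<forall>c\<in>T. x \<otimes>\<^bsub>restricted_power M\<^esub> c = c \<otimes>\<^bsub>restricted_power M\<^esub> x) \<and>
      x \<otimes>\<^bsub>restricted_power M\<^esub> y \<noteq> y \<otimes>\<^bsub>restricted_power M\<^esub> x"
proof -
  interpret monoid M by fact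
  have "finite (\<Union>c\<in>T. {i. c i \<noteq> \<one>\<^bsub>M\<^esub>})"
    using T by (auto simp: carrier_restricted_power)
  then obtain k where k: "\<And>c. c \<in> T \<Longrightarrow> c k = \<one>\<^bsub>M\<^esub>"
    using ex_new_if_finite[OF infinite_UNIV_nat] by blast
  define single where "single g = (\<lambda>i. if i = k then g else \<one>\<^bsub>M\<^esub>)" for g
  have carrier: "single g \<in> carrier (restricted_power M)" if "g \<in> carrier M" for g
    using that by (auto simp: carrier_restricted_power single_def)
  have "single a \<otimes>\<^bsub>restricted_power M\<^esub> c = c \<otimes>\<^bsub>restricted_power M\<^esub> single a" if "c \<in> T" for c
    using that T(1) a k[OF that]
    by (auto simp: mult_restricted_power single_def fun_eq_iff carrier_restricted_power)
  moreover have
    "single a \<otimes>\<^bsub>restricted_power M\<^esub> single b \<noteq> single b \<otimes>\<^bsub>restricted_power M\<^esub> single a"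
    using ab by (auto simp: mult_restricted_power single_def fun_eq_iff)
  ultimately show ?thesis
    using carrier[OF a] carrier[OF b] by blast
qed

theorem theorem3p6:
  fixes M :: "('a, 'b) monoid_scheme"
  assumes "monoid M" and "\<not> comm_monoid M"
  shows "\<not> q_omega_compact (restricted_power M)"
proof -
  obtain a b where "a \<in> carrier M" "b \<in> carrier M" "a \<otimes>\<^bsub>M\<^esub> b \<noteq> b \<otimes>\<^bsub>M\<^esub> a"
    using assms monoid.monoid_comm_monoidI by blast
  then have "\<exists>x\<in>carrier (restricted_power M). \<exists>y\<in>carrier (restricted_power M).
      (\<forall>c\<in>T. x \<otimes>\<^bsub>restricted_power M\<^esub> c = c \<otimes>\<^bsub>restricted_power M\<^esub> x) \<and>
      x \<otimes>\<^bsub>restricted_power M\<^esub> y \<noteq> y \<otimes>\<^bsub>restricted_power M\<^esub> x"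
    if "T \<subseteq> carrier (restricted_power M)" "finite T" for T
    by (rule restricted_power_noncentral_centralizer[OF assms(1) _ _ _ that])
  then show ?thesis
    by (rule not_q_omega_compact_if_noncentral_centralizers)
qed

end
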